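(* Let $S=(a_1,\dots,a_n),(b_1,\dots,b_{n'})$ be a sequence of positive integers and let $F=F_E\cup F_N$ be a set of fixed edges and non-edges such that $F$ does not contain a matching of size $3$. Let $G=(V,U,E)$ and $G'=(V,U,E')$ be two different $F$-fixed realisations of $S$. Then there exist $F$-fixed realisations $G_1,\dots,G_k$ of $S$ with $G_1=G$, $G_k=G'$ and $k\le \frac12|G\triangle G'|$ such that, for every $1\le i<k$, $|G_i\triangle G_{i+1}|=4$ and $G_i\triangle G_{i+1}$ corresponds to a $4$-swap of $G_i$.
   Context: Let $V=\{v_1,\dots,v_n\}$ and $U=\{u_1,\dots,u_{n'}\}$ be disjoint finite vertex sets. $F_E$ and $F_N$ are sets of vertex pairs $\{v_i,u_j\}$ with $v_i\in V$, $u_j\in U$ (fixed edges and fixed non-edges), and $F=F_E\cup F_N$. The set $F$ is regarded as the edge set of a bipartite graph on $V\cup U$; "$F$ contains a matching of size 3" means that $F$ contains three pairwise vertex-disjoint pairs. An $F$-fixed realisation of $S$ is a labeled simple bipartite graph $G=(V,U,E)$ (all edges between $V$ and $U$) with $d_G(v_i)=a_i$ for all $v_i\in V$, $d_G(u_j)=b_j$ for all $u_j\in U$, $F_E\subseteq E$ and $F_N\cap E=\emptyset$. For realisations $G,G'$, $G\triangle G'$ denotes the symmetric difference $E(G)\triangle E(G')$ of the edge sets. An alternating cycle of $G$ is a cycle of vertex pairs from $V\times U$ whose pairs are alternately in $E(G)$ and not in $E(G)$. A $k$-swap of $G$ is the operation that takes an alternating cycle of $G$ of length $k$ with no repeated vertex,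 deletes from $G$ its pairs lying in $E(G)$, and adds its pairs not lying in $E(G)$. "$G_i\triangle G_{i+1}$ corresponds to a $k$-swap of $G_i$" means that $G_i\triangle G_{i+1}$ is the set of pairs of such an alternating cycle of $G_i$ of length $k$. *)

theory Defs
  imports Complex_Main
begin

(* A bipartite graph on the disjoint vertex classes V and U is given by its edge set,
   a subset of vertex_pairs V U. *)

definition vertex_pairs :: "'a set \<Rightarrow> 'a set \<Rightarrow> 'a set set" where
  "vertex_pairs V U = {{v, u} | v u. v \<in> V \<and> u \<in> U}"

definition degree :: "'a set set \<Rightarrow> 'a \<Rightarrow> nat" where
  "degree E x = card {e \<in> E. x \<in> e}"

definition matching :: "'a set set \<Rightarrow> bool" where
  "matching M \<longleftrightarrow> pairwise disjnt M"

(* The lists vs and us enumerate the two vertex classes. *)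

definition realisation ::
    "'a list \<Rightarrow> 'a list \<Rightarrow> nat list \<Rightarrow> nat list \<Rightarrow> 'a set set \<Rightarrow> bool" where
  "realisation vs us a b E \<longleftrightarrow>
     E \<subseteq> vertex_pairs (set vs) (set us) \<and>
     (\<forall>i<length vs. degree E (vs ! i) = a ! i) \<and>
     (\<forall>j<length us. degree E (us ! j) = b ! j)"

definition fixed_realisation ::
    "'a list \<Rightarrow> 'a list \<Rightarrow> nat list \<Rightarrow> nat list \<Rightarrow> 'a set set \<Rightarrow> 'a set set \<Rightarrow> 'a set set \<Rightarrow> bool" where
  "fixed_realisation vs us a b F\<^sub>E F\<^sub>N E \<longleftrightarrow>
     realisation vs us a b E \<and> F\<^sub>E \<subseteq> E \<and> F\<^sub>N \<inter> E = {}"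

(* The consecutive pairs {x0,x1}, {x1,x2}, ..., {x(k-1),x0} of the closed walk x0,...,x(k-1). *)

definition cycle_pairs :: "'a list \<Rightarrow> 'a set list" where
  "cycle_pairs xs = map2 (\<lambda>x y. {x, y}) xs (rotate1 xs)"

(* Vertices may repeat here, pairs may not. Alternation is also required between the last and
   the first pair. *)

definition alternating_cycle :: "'a set \<Rightarrow> 'a set \<Rightarrow> 'a set set \<Rightarrow> 'a list \<Rightarrow> bool" where
  "alternating_cycle V U E xs \<longleftrightarrow>
     xs \<noteq> [] \<and>
     distinct (cycle_pairs xs) \<and>
     set (cycle_pairs xs) \<subseteq> vertex_pairs V U \<and>
     (\<forall>i<length xs. cycle_pairs xs ! i \<in> E \<longleftrightarrow>
        cycle_pairs xs ! (Suc i mod length xs) \<notin> E)"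

(* Deleting the pairs of D in E and adding those not in E is a k-swap of E;
   the resulting edge set is sym_diff E D. *)

definition corresponds_to_swap ::
    "'a set \<Rightarrow> 'a set \<Rightarrow> nat \<Rightarrow> 'a set set \<Rightarrow> 'a set set \<Rightarrow> bool" where
  "corresponds_to_swap V U k E D \<longleftrightarrow>
     (\<exists>xs. alternating_cycle V U E xs \<and> length xs = k \<and> distinct xs \<and>
           D = set (cycle_pairs xs))"

end

theory Submission
  imports Defs
begin

text \<open>
  Orient the pairs of \<open>G - G'\<close> from \<open>V\<close> to \<open>U\<close> and those of \<open>G' - G\<close> from \<open>U\<close> to \<open>V\<close>. Since the
  degrees agree, every vertex that is entered can be left, so there is a closed walk; a shortest
  one, \<open>x\<close>, has no arc from \<open>x i\<close> to \<open>x (i + 3)\<close>. Start it in \<open>V\<close>. The chords \<open>{x 0, x 3}\<close>,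
  \<open>{x 2, x 5}\<close>, \<open>{x 4, x 7}\<close> either form a matching of size 3 or one of them lies in \<open>G \<triangle> G'\<close>, so one
  of them, say \<open>{x 0, x 3}\<close>, is not fixed. As it is not in \<open>G - G'\<close>, it is either missing in \<open>G\<close> or
  present in \<open>G'\<close>; hence the 4-cycle on \<open>x 0, x 1, x 2, x 3\<close> is alternating in \<open>G\<close> or in \<open>G'\<close>, and
  swapping it there removes three pairs from \<open>G \<triangle> G'\<close> and adds at most one. Swaps of \<open>G'\<close> are
  reversible, so induction on the size of \<open>G \<triangle> G'\<close> concludes.
\<close>

section \<open>Closed walks without shortcuts in a finite digraph\<close>

text \<open>A closed walk of least length \<open>L\<close>, repeated periodically, works: an arc
  from \<open>x i\<close> to \<open>x (i + 3)\<close> would replace three steps by one and give a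
  closed walk of length \<open>L - 2\<close>.\<close>

lemma shortcut_free_walk:
  fixes A :: "('a \<times> 'a) set"
  assumes fin: "finite A" and ne: "A \<noteq> {}"
    and succ: "\<And>x y. (x, y) \<in> A \<Longrightarrow> \<exists>z. (y, z) \<in> A"
    and asym: "\<And>x y. (x, y) \<in> A \<Longrightarrow> (y, x) \<notin> A"
  obtains x :: "nat \<Rightarrow> 'a"
  where "\<And>i. (x i, x (Suc i)) \<in> A" and "\<And>i. (x i, x (i + 3)) \<notin> A"
proof -
  have "\<not> acyclic A"
  proof
    assume "acyclic A"
    with fin have wf: "wf (A\<inverse>)"
      by (rule finite_acyclic_wf_converse)
    from ne obtain p q where "(p, q) \<in> A"
      by auto
    then have "q \<in> Range A"
      by auto
    \<comment> \<open>The vertex \<open>z\<close> is entered, so by \<open>succ\<close> it can be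
      left, and the vertex reached lies in \<open>Range A\<close> again, against minimality.\<close>
    from wfE_min[OF wf this] obtain z
      where z: "z \<in> Range A" "\<And>y. (y, z) \<in> A\<inverse> \<Longrightarrow> y \<notin> Range A"
      by blast
    then show False
      using succ by blast
  qed
  then obtain w where "(w, w) \<in> A\<^sup>+"
    by (auto simp: acyclic_def)
  then have "\<exists>L. 0 < L \<and> (\<exists>w. (w, w) \<in> A ^^ L)"
    by (auto simp: trancl_power)
  from exists_least_iff[THEN iffD1, OF this] obtain L
    where "0 < L" and "\<exists>w. (w, w) \<in> A ^^ L"
      and least: "\<And>m w. m < L \<Longrightarrow> 0 < m \<Longrightarrow> (w, w) \<notin> A ^^ m"
    by blast
  then obtain f where f: "f 0 = f L" "\<And>i. i < L \<Longrightarrow> (f i, f (Suc i)) \<in> A"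
    by (metis relpow_fun_conv)
  \<comment> \<open>As \<open>f 0 = f L\<close>, reading the indices modulo \<open>L\<close> yields
    an endless walk, so \<open>i + 3\<close> needs no wrap-around.\<close>
  define x where "x i = f (i mod L)" for i
  have walk: "(x i, x (Suc i)) \<in> A" for i
  proof -
    have "i mod L < L"
      using \<open>0 < L\<close> by simp
    then show ?thesis
      using f(2)[of "i mod L"] f(1) by (auto simp: x_def mod_Suc)
  qed
  \<comment> \<open>\<open>asym\<close> rules out loops and 2-cycles; with \<open>3 \<le> L\<close>
    the subtraction \<open>L - 3\<close> below is not truncated.\<close>
  have "L \<noteq> 1"
    using f asym by (metis One_nat_def less_one)
  moreover have "L \<noteq> 2"
    using f(1) f(2)[of 0] f(2)[of 1] asym by (auto simp: numeral_2_eq_2)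
  ultimately have "3 \<le> L"
    using \<open>0 < L\<close> by simp
  have "(x i, x (i + 3)) \<notin> A" for i
  proof
    assume "(x i, x (i + 3)) \<in> A"
    moreover have "(x (i + 3), x (i + L)) \<in> A ^^ (L - 3)"
      unfolding relpow_fun_conv
      using walk[of "i + 3 + _"] \<open>3 \<le> L\<close> by (intro exI[of _ "\<lambda>j. x (i + 3 + j)"]) simp
    then have "(x (i + 3), x i) \<in> A ^^ (L - 3)"
      by (simp add: x_def)
    ultimately have "(x i, x i) \<in> A ^^ Suc (L - 3)"
      by (rule relpow_Suc_I2)
    then show False
      using least[of "Suc (L - 3)"] \<open>3 \<le> L\<close> by simp
  qed
  with walk that show thesis
    by blast
qed

section \<open>Degree exchange and reversal of swaps\<close>

lemma finite_vertex_pairs: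
  assumes "finite V" and "finite U"
  shows "finite (vertex_pairs V U)"
proof -
  have "vertex_pairs V U = (\<lambda>(v, u). {v, u}) ` (V \<times> U)"
    by (auto simp: vertex_pairs_def)
  with assms show ?thesis
    by simp
qed

text \<open>Otherwise the pairs of \<open>E'\<close> at \<open>x\<close> would form a proper subset
  of those of \<open>E\<close> at \<open>x\<close>, as \<open>e\<close> is missing, and the degrees
  would differ.\<close>

lemma degree_eq_exchange:
  assumes "finite E" and "finite E'" and "degree E x = degree E' x"
    and "e \<in> E - E'" and "x \<in> e"
  obtains e' where "e' \<in> E' - E" and "x \<in> e'"
proof -
  have "\<not> {e \<in> E'. x \<in> e} \<subset> {e \<in> E. x \<in> e}"
    using psubset_card_mono[of "{e \<in> E. x \<in> e}" "{e \<in> E'. x \<in> e}"] assms(1,3)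
    by (auto simp: degree_def)
  with assms(4,5) that show thesis
    by blast
qed

text \<open>The swap flips the membership of every pair of the cycle, and alternation is invariant
  under flipping all of them.\<close>

lemma alternating_cycle_after_swap:
  assumes "alternating_cycle V U E xs"
  shows "alternating_cycle V U (sym_diff E (set (cycle_pairs xs))) xs"
proof -
  let ?c = "cycle_pairs xs" and ?E' = "sym_diff E (set (cycle_pairs xs))"
  have "length ?c = length xs"
    by (simp add: cycle_pairs_def)
  then have flip: "?c ! i \<in> ?E' \<longleftrightarrow> ?c ! i \<notin> E" if "i < length xs" for i
    using that by auto
  have "?c ! i \<in> ?E' \<longleftrightarrow> ?c ! (Suc i mod length xs) \<notin> ?E'" if "i < length xs" for i
  proof -
    have "0 < length xs"
      using that by linarith
    then have "Suc i mod length xs < length xs"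
      by (rule mod_less_divisor)
    moreover have "?c ! i \<in> E \<longleftrightarrow> ?c ! (Suc i mod length xs) \<notin> E"
      using assms that unfolding alternating_cycle_def by blast
    ultimately show ?thesis
      using flip that by blast
  qed
  then show ?thesis
    using assms unfolding alternating_cycle_def by blast
qed

text \<open>The same cycle undoes the swap. This allows swaps to be made at the \<open>G'\<close>
  end of the sequence and then read backwards.\<close>

lemma corresponds_to_swap_reverse:
  assumes "corresponds_to_swap V U k E (sym_diff E E')"
  shows "corresponds_to_swap V U k E' (sym_diff E' E)"
proof -
  obtain xs where xs: "alternating_cycle V U E xs" "length xs = k" "distinct xs"
    "sym_diff E E' = set (cycle_pairs xs)"
    using assms by (auto simp: corresponds_to_swap_def)
  have "sym_diff E (set (cycle_pairs xs)) = E'"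
    unfolding xs(4)[symmetric] by auto
  then have "alternating_cycle V U E' xs"
    using alternating_cycle_after_swap[OF xs(1)] by simp
  moreover have "sym_diff E' E = set (cycle_pairs xs)"
    using xs(4) by auto
  ultimately show ?thesis
    using xs(2,3) by (auto simp: corresponds_to_swap_def)
qed

section \<open>Swaps along a 4-cycle\<close>

text \<open>As a relation, it turns sequences of \<open>n\<close> swaps into members of its
  \<open>n\<close>-th relational power.\<close>

definition swap_step ::
    "'a list \<Rightarrow> 'a list \<Rightarrow> nat list \<Rightarrow> nat list \<Rightarrow> 'a set set \<Rightarrow> 'a set set \<Rightarrow> ('a set set \<times> 'a set set) set"
  where
  "swap_step vs us a b F\<^sub>E F\<^sub>N =
     {(E, E'). fixed_realisation vs us a b F\<^sub>E F\<^sub>N E \<and> fixed_realisation vs us a b F\<^sub>E F\<^sub>N E' \<and>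
        card (sym_diff E E') = 4 \<and>
        corresponds_to_swap (set vs) (set us) 4 E (sym_diff E E')}"

lemma swap_step_sym:
  assumes "(E, E') \<in> swap_step vs us a b F\<^sub>E F\<^sub>N"
  shows "(E', E) \<in> swap_step vs us a b F\<^sub>E F\<^sub>N"
  using assms corresponds_to_swap_reverse[of _ _ 4 E E']
  by (simp add: swap_step_def Un_commute)

definition quad_pairs :: "'a \<Rightarrow> 'a \<Rightarrow> 'a \<Rightarrow> 'a \<Rightarrow> 'a set set" where
  "quad_pairs p q r s = {{p, q}, {q, r}, {r, s}, {s, p}}"

text \<open>Each of the four vertices lies on one pair of the cycle in \<open>E\<close> and one
  outside, so it loses one edge and gains one.\<close>

lemma degree_swap:
  assumes "finite E" and "distinct [p, q, r, s]"
    and "{p, q} \<in> E" and "{q, r} \<notin> E" and "{r, s} \<in> E" and "{s, p} \<notin> E"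
  shows "degree (sym_diff E (quad_pairs p q r s)) y = degree E y"
proof -
  let ?E' = "sym_diff E (quad_pairs p q r s)"
  have replace: "degree ?E' y = degree E y"
    if "e \<in> E" "y \<in> e" "e' \<notin> E" "{d \<in> ?E'. y \<in> d} = insert e' ({d \<in> E. y \<in> d} - {e})"
    for e e'
  proof -
    have "finite {d \<in> E. y \<in> d}"
      using assms(1) by simp
    moreover have "e \<in> {d \<in> E. y \<in> d}"
      using that by simp
    ultimately have "Suc (card ({d \<in> E. y \<in> d} - {e})) = card {d \<in> E. y \<in> d}"
      by (rule card_Suc_Diff1)
    then show ?thesis
      unfolding degree_def that(4) using that(3) \<open>finite {d \<in> E. y \<in> d}\<close> by simp
  qed
  consider "y = p" | "y = q" | "y = r" | "y = s" | "y \<notin> {p, q, r, s}"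
    by auto
  then show ?thesis
  proof cases
    case 1
    show ?thesis
      by (rule replace[of "{p, q}" "{s, p}"])
        (use assms 1 in \<open>auto simp: quad_pairs_def doubleton_eq_iff\<close>)
  next
    case 2
    show ?thesis
      by (rule replace[of "{p, q}" "{q, r}"])
        (use assms 2 in \<open>auto simp: quad_pairs_def doubleton_eq_iff\<close>)
  next
    case 3
    show ?thesis
      by (rule replace[of "{r, s}" "{q, r}"])
        (use assms 3 in \<open>auto simp: quad_pairs_def doubleton_eq_iff\<close>)
  next
    case 4
    show ?thesis
      by (rule replace[of "{r, s}" "{s, p}"])
        (use assms 4 in \<open>auto simp: quad_pairs_def doubleton_eq_iff\<close>)
  next
    case 5
    then have "{d \<in> ?E'. y \<in> d} = {d \<in> E. y \<in> d}"
      by (auto simp: quad_pairs_def)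
    then show ?thesis
      by (simp add: degree_def)
  qed
qed

lemma swap_step_quad:
  assumes E: "fixed_realisation vs us a b F\<^sub>E F\<^sub>N E"
    and disj: "set vs \<inter> set us = {}"
    and "p \<in> set vs" and "q \<in> set us" and "r \<in> set vs" and "s \<in> set us"
    and "p \<noteq> r" and "q \<noteq> s"
    and alt: "{p, q} \<in> E" "{q, r} \<notin> E" "{r, s} \<in> E" "{s, p} \<notin> E"
    and free: "quad_pairs p q r s \<inter> (F\<^sub>E \<union> F\<^sub>N) = {}"
  shows "(E, sym_diff E (quad_pairs p q r s)) \<in> swap_step vs us a b F\<^sub>E F\<^sub>N"
proof -
  let ?E' = "sym_diff E (quad_pairs p q r s)"
  have dist: "distinct [p, q, r, s]"
    using assms(2-8) by auto
  have pairs: "quad_pairs p q r s \<subseteq> vertex_pairs (set vs) (set us)"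
    using assms(3-6) unfolding quad_pairs_def vertex_pairs_def by blast
  have sub: "E \<subseteq> vertex_pairs (set vs) (set us)"
    using E by (simp add: fixed_realisation_def realisation_def)
  then have "finite E"
    by (rule finite_subset) (simp add: finite_vertex_pairs)
  then have deg: "degree ?E' y = degree E y" for y
    using dist alt by (rule degree_swap)
  \<comment> \<open>The symmetric difference touches only pairs of the cycle, none of which is
    fixed.\<close>
  have "F\<^sub>E \<subseteq> ?E' \<and> F\<^sub>N \<inter> ?E' = {}"
    using E free unfolding fixed_realisation_def by blast
  moreover have "?E' \<subseteq> vertex_pairs (set vs) (set us)"
    using sub pairs by blast
  ultimately have E': "fixed_realisation vs us a b F\<^sub>E F\<^sub>N ?E'"
    using E by (simp add: fixed_realisation_def realisation_def deg)
  have diff: "sym_diff E ?E' = quad_pairs p q r s"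
    by auto
  have dist_pairs: "distinct [{p, q}, {q, r}, {r, s}, {s, p}]"
    using dist by (auto simp: doubleton_eq_iff)
  then have card: "card (quad_pairs p q r s) = 4"
    using distinct_card[OF dist_pairs] by (simp add: quad_pairs_def)
  have cyc: "cycle_pairs [p, q, r, s] = [{p, q}, {q, r}, {r, s}, {s, p}]"
    by (simp add: cycle_pairs_def)
  have alternate: "cycle_pairs [p, q, r, s] ! i \<in> E \<longleftrightarrow> cycle_pairs [p, q, r, s] ! (Suc i mod 4) \<notin> E"
    if "i < 4" for i
  proof -
    from that consider "i = 0" | "i = 1" | "i = 2" | "i = 3"
      by linarith
    then show ?thesis
      by cases (simp_all add: cyc alt)
  qed
  have len: "length [p, q, r, s] = 4"
    by simp
  have "alternating_cycle (set vs) (set us) E [p, q, r, s]"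
    unfolding alternating_cycle_def len
  proof (intro conjI allI impI)
    show "set (cycle_pairs [p, q, r, s]) \<subseteq> vertex_pairs (set vs) (set us)"
      using pairs by (simp add: cyc quad_pairs_def)
  qed (use alternate cyc dist_pairs in \<open>simp_all only:\<close>, simp)
  then have "corresponds_to_swap (set vs) (set us) 4 E (quad_pairs p q r s)"
    using dist unfolding corresponds_to_swap_def
    by (intro exI[of _ "[p, q, r, s]"]) (auto simp: cyc quad_pairs_def)
  with E E' diff card show ?thesis
    by (simp add: swap_step_def)
qed

section \<open>A swap that brings the two realisations closer\<close>

lemma card_sym_diff_three:
  assumes "finite D" and "{e1, e2, e3} \<subseteq> D" and "card {e1, e2, e3} = 3"
  shows "card (sym_diff D {e1, e2, e3, e4}) + 2 \<le> card D"
proof -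
  \<comment> \<open>It is open whether \<open>e4\<close> lies in \<open>D\<close>; the worst case is
    that it does not and gets added.\<close>
  have "sym_diff D {e1, e2, e3, e4} \<subseteq> insert e4 (D - {e1, e2, e3})"
    using assms(2) by auto
  then have "card (sym_diff D {e1, e2, e3, e4}) \<le> card (insert e4 (D - {e1, e2, e3}))"
    by (intro card_mono) (use assms(1) in auto)
  also have "\<dots> \<le> Suc (card (D - {e1, e2, e3}))"
    by (rule card_insert_le_m1[THEN le_trans]) (auto simp: assms(1))
  also have "card (D - {e1, e2, e3}) = card D - 3"
    using assms by (simp add: card_Diff_subset)
  finally show ?thesis
    using card_mono[OF assms(1,2)] assms(3) by linarith
qed

text \<open>The chord closes the path to a 4-cycle, alternating in \<open>G\<close> if the chord is
  missing there and in \<open>G'\<close> if it is present there. Since the chord is not in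
  \<open>G - G'\<close>, one of the two cases applies.\<close>

lemma alternating_path_swap:
  assumes G: "fixed_realisation vs us a b F\<^sub>E F\<^sub>N G"
    and G': "fixed_realisation vs us a b F\<^sub>E F\<^sub>N G'"
    and disj: "set vs \<inter> set us = {}"
    and in_VU: "p \<in> set vs" "q \<in> set us" "r \<in> set vs" "s \<in> set us"
    and path: "{p, q} \<in> G - G'" "{q, r} \<in> G' - G" "{r, s} \<in> G - G'"
    and chord: "{s, p} \<notin> G - G'" "{s, p} \<notin> F\<^sub>E \<union> F\<^sub>N"
  shows "\<exists>H. (G, H) \<in> swap_step vs us a b F\<^sub>E F\<^sub>N \<and> card (sym_diff H G') + 2 \<le> card (sym_diff G G') \<or>
             (H, G') \<in> swap_step vs us a b F\<^sub>E F\<^sub>N \<and> card (sym_diff G H) + 2 \<le> card (sym_diff G G')"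
proof -
  let ?D = "sym_diff G G'" and ?C = "quad_pairs p q r s"
  have "G \<subseteq> vertex_pairs (set vs) (set us)" "G' \<subseteq> vertex_pairs (set vs) (set us)"
    using G G' by (simp_all add: fixed_realisation_def realisation_def)
  then have "finite ?D"
    by (meson List.finite_set finite_Diff finite_Un finite_subset finite_vertex_pairs)
  have ne: "p \<noteq> r" "q \<noteq> s"
    using path by (auto simp: insert_commute)
  have "distinct [p, q, r, s]"
    using ne in_VU disj by auto
  then have "distinct [{p, q}, {q, r}, {r, s}]"
    by (auto simp: doubleton_eq_iff)
  from distinct_card[OF this] have three: "card {{p, q}, {q, r}, {r, s}} = 3"
    by simp
  have "card (sym_diff ?D ?C) + 2 \<le> card ?D"
    unfolding quad_pairs_def
    by (rule card_sym_diff_three[OF \<open>finite ?D\<close> _ three]) (use path in auto)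
  moreover have "sym_diff (sym_diff G ?C) G' = sym_diff ?D ?C"
    and "sym_diff G (sym_diff G' ?C) = sym_diff ?D ?C"
    by auto
  \<comment> \<open>A pair in exactly one of \<open>G\<close> and \<open>G'\<close> cannot be fixed;
    this covers the three pairs of the path.\<close>
  moreover have free: "?C \<inter> (F\<^sub>E \<union> F\<^sub>N) = {}"
    using path chord(2) G G' unfolding quad_pairs_def fixed_realisation_def by blast
  moreover have "(G, sym_diff G ?C) \<in> swap_step vs us a b F\<^sub>E F\<^sub>N" if "{s, p} \<notin> G"
    using path that by (intro swap_step_quad[OF G disj in_VU ne _ _ _ _ free]) auto
  moreover have "(G', sym_diff G' ?C) \<in> swap_step vs us a b F\<^sub>E F\<^sub>N" if "{s, p} \<in> G'"
  proof -
    \<comment> \<open>In \<open>G'\<close> the present pairs are \<open>{p, s}\<close> and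
      \<open>{r, q}\<close>, so the cycle is traversed the other way round.\<close>
    have eq: "quad_pairs p s r q = ?C"
      by (auto simp: quad_pairs_def insert_commute)
    have "(G', sym_diff G' (quad_pairs p s r q)) \<in> swap_step vs us a b F\<^sub>E F\<^sub>N"
      by (rule swap_step_quad[OF G' disj])
        (use path that in_VU ne free eq in \<open>auto simp: insert_commute\<close>)
    then show ?thesis
      by (simp add: eq)
  qed
  ultimately show ?thesis
    using chord(1) swap_step_sym by (metis DiffI)
qed

lemma three_pairs_matching:
  assumes "V \<inter> U = {}" and "{p1, p2, p3} \<subseteq> V" and "{q1, q2, q3} \<subseteq> U"
    and "distinct [p1, p2, p3]" and "distinct [q1, q2, q3]"
  shows "matching {{p1, q1}, {p2, q2}, {p3, q3}}" and "card {{p1, q1}, {p2, q2}, {p3, q3}} = 3"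
proof -
  have dist: "distinct [p1, p2, p3, q1, q2, q3]"
    using assms by auto
  then show "matching {{p1, q1}, {p2, q2}, {p3, q3}}"
    by (simp add: matching_def pairwise_insert disjnt_def) blast
  from dist have "distinct [{p1, q1}, {p2, q2}, {p3, q3}]"
    by (auto simp: doubleton_eq_iff)
  from distinct_card[OF this] show "card {{p1, q1}, {p2, q2}, {p3, q3}} = 3"
    by simp
qed

lemma exists_reducing_swap:
  assumes disj: "set vs \<inter> set us = {}"
    and no_matching: "\<not> (\<exists>M. M \<subseteq> F\<^sub>E \<union> F\<^sub>N \<and> matching M \<and> card M = 3)"
    and G: "fixed_realisation vs us a b F\<^sub>E F\<^sub>N G"
    and G': "fixed_realisation vs us a b F\<^sub>E F\<^sub>N G'"
    and "G \<noteq> G'"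
  shows "\<exists>H. (G, H) \<in> swap_step vs us a b F\<^sub>E F\<^sub>N \<and> card (sym_diff H G') + 2 \<le> card (sym_diff G G') \<or>
             (H, G') \<in> swap_step vs us a b F\<^sub>E F\<^sub>N \<and> card (sym_diff G H) + 2 \<le> card (sym_diff G G')"
proof -
  let ?V = "set vs" and ?U = "set us"
  have sub: "G \<subseteq> vertex_pairs ?V ?U" "G' \<subseteq> vertex_pairs ?V ?U"
    using G G' by (simp_all add: fixed_realisation_def realisation_def)
  then have fin: "finite G" "finite G'"
    by (meson List.finite_set finite_subset finite_vertex_pairs)+
  have deg: "degree G y = degree G' y" if "y \<in> ?V \<union> ?U" for y
    using that G G' by (auto simp: fixed_realisation_def realisation_def in_set_conv_nth)
  \<comment> \<open>With this orientation every directed walk alternates between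
    \<open>G - G'\<close> and \<open>G' - G\<close>.\<close>
  define A where "A = {(v, u). v \<in> ?V \<and> u \<in> ?U \<and> {v, u} \<in> G - G'} \<union>
                      {(u, v). u \<in> ?U \<and> v \<in> ?V \<and> {u, v} \<in> G' - G}"
  have arc_V: "y \<in> ?U \<and> {x, y} \<in> G - G'" if "(x, y) \<in> A" "x \<in> ?V" for x y
    using that disj by (auto simp: A_def)
  have arc_U: "y \<in> ?V \<and> {x, y} \<in> G' - G" if "(x, y) \<in> A" "x \<in> ?U" for x y
    using that disj by (auto simp: A_def)
  have finA: "finite A"
    by (rule finite_subset[of _ "(?V \<union> ?U) \<times> (?V \<union> ?U)"]) (auto simp: A_def)
  \<comment> \<open>A vertex of \<open>V\<close> is entered along a pair of \<open>G' - G\<close>;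
    degree exchange supplies a pair of \<open>G - G'\<close> at it, which is directed
    outwards.\<close>
  have out_V: "\<exists>u. (v, u) \<in> A" if "v \<in> ?V" and e: "e \<in> G' - G" "v \<in> e" for v e
  proof -
    obtain e' where "e' \<in> G - G'" "v \<in> e'"
      using degree_eq_exchange[OF fin(2,1) deg[symmetric] e] \<open>v \<in> ?V\<close> by auto
    moreover then obtain v' u where "e' = {v', u}" "v' \<in> ?V" "u \<in> ?U"
      using sub(1) by (auto simp: vertex_pairs_def)
    ultimately show ?thesis
      using \<open>v \<in> ?V\<close> disj by (auto simp: A_def)
  qed
  have out_U: "\<exists>v. (u, v) \<in> A" if "u \<in> ?U" and e: "e \<in> G - G'" "u \<in> e" for u e
  proof -
    obtain e' where "e' \<in> G' - G" "u \<in> e'"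
      using degree_eq_exchange[OF fin deg e] \<open>u \<in> ?U\<close> by auto
    moreover then obtain v u' where "e' = {v, u'}" "v \<in> ?V" "u' \<in> ?U"
      using sub(2) unfolding vertex_pairs_def by blast
    ultimately show ?thesis
      using \<open>u \<in> ?U\<close> disj by (auto simp: A_def insert_commute)
  qed
  have succ: "\<exists>z. (y, z) \<in> A" if "(x, y) \<in> A" for x y
    using that out_V[of y "{x, y}"] out_U[of y "{x, y}"] by (auto simp: A_def)
  have asym: "(y, x) \<notin> A" if "(x, y) \<in> A" for x y
    using that disj by (auto simp: A_def insert_commute)
  have neA: "A \<noteq> {}"
  proof -
    obtain e where "e \<in> G - G' \<or> e \<in> G' - G"
      using \<open>G \<noteq> G'\<close> by blast
    moreover then obtain v u where "e = {v, u}" "v \<in> ?V" "u \<in> ?U"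
      using sub by (auto simp: vertex_pairs_def)
    ultimately show ?thesis
      using out_V[of v e] out_U[of u e] by auto
  qed
  obtain w where w: "\<And>i. (w i, w (Suc i)) \<in> A" "\<And>i. (w i, w (i + 3)) \<notin> A"
    by (rule shortcut_free_walk[OF finA neA]) (use succ asym in blast)+
  \<comment> \<open>If \<open>w\<close> starts in \<open>U\<close>, its first vertex is dropped;
    both properties of \<open>w\<close> survive the shift.\<close>
  define x where "x i = w (i + (if w 0 \<in> ?V then 0 else 1))" for i
  have "w 0 \<in> ?V \<or> w 1 \<in> ?V"
    using w(1)[of 0] by (auto simp: A_def)
  then have x: "(x i, x (Suc i)) \<in> A" "(x i, x (i + 3)) \<notin> A" "x 0 \<in> ?V" for i
    using w(1)[of "Suc i"] w(1)[of i] w(2)[of i] w(2)[of "Suc i"] by (auto simp: x_def)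
  have parity: "x (2 * i) \<in> ?V \<and> x (Suc (2 * i)) \<in> ?U" for i
  proof (induction i)
    case 0
    then show ?case
      using x(3) arc_V[OF x(1)[of 0]] by simp
  next
    case (Suc i)
    then have "x (Suc (Suc (2 * i))) \<in> ?V"
      using arc_U[OF x(1)] by blast
    then show ?case
      using arc_V[OF x(1)] by simp
  qed
  have red: "{x (2 * i), x (Suc (2 * i))} \<in> G - G'" for i
    using arc_V[OF x(1)] parity by blast
  have blue: "{x (Suc (2 * i)), x (2 * Suc i)} \<in> G' - G" for i
    using arc_U[OF x(1)[of "Suc (2 * i)"]] parity[of i] by simp
  have unfixed: "e \<notin> F\<^sub>E \<union> F\<^sub>N" if "e \<in> sym_diff G G'" for e
    using that G G' by (auto simp: fixed_realisation_def)
  have "\<exists>i. {x (2 * i), x (2 * i + 3)} \<notin> F\<^sub>E \<union> F\<^sub>N"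
  proof (rule ccontr)
    assume "\<not> ?thesis"
    then have fixed: "{x (2 * i), x (2 * i + 3)} \<in> F\<^sub>E \<union> F\<^sub>N" for i
      by blast
    have F: "{x 0, x 3} \<in> F\<^sub>E \<union> F\<^sub>N" "{x 2, x 5} \<in> F\<^sub>E \<union> F\<^sub>N" "{x 4, x 7} \<in> F\<^sub>E \<union> F\<^sub>N"
      using fixed[of 0] fixed[of 1] fixed[of 2] by simp_all
    have R: "{x 0, x 1} \<in> G - G'" "{x 2, x 3} \<in> G - G'" "{x 4, x 5} \<in> G - G'" "{x 6, x 7} \<in> G - G'"
      using red[of 0] red[of 1] red[of 2] red[of 3] by simp_all
    have B: "{x 1, x 2} \<in> G' - G" "{x 3, x 4} \<in> G' - G" "{x 5, x 6} \<in> G' - G"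
      using blue[of 0] blue[of 1] blue[of 2] by simp_all
    \<comment> \<open>Each of these equalities would identify a pair of \<open>G - G'\<close> with
      an adjacent pair of \<open>G' - G\<close>.\<close>
    have "x 0 \<noteq> x 2" "x 2 \<noteq> x 4" "x 3 \<noteq> x 5" "x 5 \<noteq> x 7"
      using R B by (auto simp: insert_commute)
    \<comment> \<open>Here equality would turn a chord, assumed fixed, into
      \<open>{x 3, x 4}\<close>, which lies in \<open>G' - G\<close> and so is not fixed.\<close>
    moreover have "x 0 \<noteq> x 4" "x 3 \<noteq> x 7"
      using F(1,3) unfixed[of "{x 3, x 4}"] B(2) by (auto simp: insert_commute)
    ultimately have dist: "distinct [x 0, x 2, x 4]" "distinct [x 3, x 5, x 7]"
      by simp_all
    have subsets: "{x 0, x 2, x 4} \<subseteq> ?V" "{x 3, x 5, x 7} \<subseteq> ?U"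
      using parity[of 0] parity[of 1] parity[of 2] parity[of 3] by simp_all
    have "{{x 0, x 3}, {x 2, x 5}, {x 4, x 7}} \<subseteq> F\<^sub>E \<union> F\<^sub>N"
      using F by blast
    with three_pairs_matching[OF disj subsets dist] no_matching show False
      by blast
  qed
  then obtain i where chord: "{x (2 * i), x (2 * i + 3)} \<notin> F\<^sub>E \<union> F\<^sub>N" ..
  let ?p = "x (2 * i)" and ?q = "x (Suc (2 * i))" and ?r = "x (2 * Suc i)" and ?s = "x (Suc (2 * Suc i))"
  have s: "x (2 * i + 3) = ?s"
    by (simp add: numeral_3_eq_3)
  show ?thesis
  proof (rule alternating_path_swap[OF G G' disj, of ?p ?q ?r ?s])
    \<comment> \<open>Otherwise the chord, running from \<open>V\<close> to \<open>U\<close>, would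
      be a shortcut arc of \<open>A\<close>.\<close>
    show "{?s, ?p} \<notin> G - G'"
      using x(2)[of "2 * i"] parity[of i] parity[of "Suc i"] unfolding s
      by (auto simp: A_def insert_commute)
    show "{?s, ?p} \<notin> F\<^sub>E \<union> F\<^sub>N"
      using chord unfolding s by (simp add: insert_commute)
  qed (use parity red blue in blast)+
qed

section \<open>Chaining the swaps\<close>

text \<open>Each swap lowers the difference by at least 2. The extra 2 in the bound comes from a
  path of one swap, where the difference is 4; it is what makes \<open>n + 1\<close> realisations
  fit into half of the difference.\<close>

lemma swap_path:
  assumes disj: "set vs \<inter> set us = {}"
    and no_matching: "\<not> (\<exists>M. M \<subseteq> F\<^sub>E \<union> F\<^sub>N \<and> matching M \<and> card M = 3)"
    and "fixed_realisation vs us a b F\<^sub>E F\<^sub>N G"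
    and "fixed_realisation vs us a b F\<^sub>E F\<^sub>N G'"
    and "G \<noteq> G'"
  shows "\<exists>n. 2 * n + 2 \<le> card (sym_diff G G') \<and> (G, G') \<in> swap_step vs us a b F\<^sub>E F\<^sub>N ^^ n"
  using assms(3-5)
proof (induction "card (sym_diff G G')" arbitrary: G G' rule: less_induct)
  case less
  let ?R = "swap_step vs us a b F\<^sub>E F\<^sub>N"
  have one: ?case if "(G, G') \<in> ?R"
    using that by (intro exI[of _ 1]) (auto simp: swap_step_def)
  obtain H where "(G, H) \<in> ?R \<and> card (sym_diff H G') + 2 \<le> card (sym_diff G G') \<or>
      (H, G') \<in> ?R \<and> card (sym_diff G H) + 2 \<le> card (sym_diff G G')"
    using exists_reducing_swap[OF disj no_matching less.prems] by blast
  then show ?case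
  proof (elim disjE conjE)
    \<comment> \<open>A swap at \<open>G\<close> is prepended to the path from \<open>H\<close>; in
      the other case a swap into \<open>G'\<close> is appended. The induction hypothesis needs
      different graphs, so equality is treated by \<open>one\<close>.\<close>
    assume H: "(G, H) \<in> ?R" "card (sym_diff H G') + 2 \<le> card (sym_diff G G')"
    show ?case
    proof (cases "H = G'")
      case False
      then obtain n where "2 * n + 2 \<le> card (sym_diff H G')" "(H, G') \<in> ?R ^^ n"
        using less.hyps[of H G'] H less.prems by (auto simp: swap_step_def)
      with H show ?thesis
        by (intro exI[of _ "Suc n"]) (auto intro: relpow_Suc_I2 simp del: relpow.simps)
    qed (use H one in simp)
  next
    assume H: "(H, G') \<in> ?R" "card (sym_diff G H) + 2 \<le> card (sym_diff G G')"
    show ?case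
    proof (cases "H = G")
      case False
      then obtain n where "2 * n + 2 \<le> card (sym_diff G H)" "(G, H) \<in> ?R ^^ n"
        using less.hyps[of G H] H less.prems by (auto simp: swap_step_def)
      with H show ?thesis
        by (intro exI[of _ "Suc n"]) auto
    qed (use H one in simp)
  qed
qed

theorem theorem1:
  fixes vs us :: "'a list" and a b :: "nat list"
    and F\<^sub>E F\<^sub>N G G' :: "'a set set"
  assumes "distinct vs" and "distinct us" and "set vs \<inter> set us = {}"
    and "length a = length vs" and "length b = length us"
    and "\<forall>x\<in>set a. 0 < x" and "\<forall>x\<in>set b. 0 < x"
    and "F\<^sub>E \<subseteq> vertex_pairs (set vs) (set us)"
    and "F\<^sub>N \<subseteq> vertex_pairs (set vs) (set us)"
    and "\<not> (\<exists>M. M \<subseteq> F\<^sub>E \<union> F\<^sub>N \<and> matching M \<and> card M = 3)"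
    and "fixed_realisation vs us a b F\<^sub>E F\<^sub>N G"
    and "fixed_realisation vs us a b F\<^sub>E F\<^sub>N G'"
    and "G \<noteq> G'"
  shows "\<exists>(k::nat) (H :: nat \<Rightarrow> 'a set set).
           1 \<le> k \<and> H 1 = G \<and> H k = G' \<and>
           real k \<le> 1 / 2 * real (card (sym_diff G G')) \<and>
           (\<forall>i\<in>{1..k}. fixed_realisation vs us a b F\<^sub>E F\<^sub>N (H i)) \<and>
           (\<forall>i. 1 \<le> i \<and> i < k \<longrightarrow>
              card (sym_diff (H i) (H (i + 1))) = 4 \<and>
              corresponds_to_swap (set vs) (set us) 4 (H i) (sym_diff (H i) (H (i + 1))))"
proof -
  let ?R = "swap_step vs us a b F\<^sub>E F\<^sub>N"
  obtain n where n: "2 * n + 2 \<le> card (sym_diff G G')" "(G, G') \<in> ?R ^^ n"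
    using swap_path[OF assms(3,10-13)] by blast
  then obtain f where f: "f 0 = G" "f n = G'" "\<And>i. i < n \<Longrightarrow> (f i, f (Suc i)) \<in> ?R"
    by (auto simp: relpow_fun_conv)
  \<comment> \<open>Every \<open>f i\<close> is either the given \<open>G\<close> or the target of a
    swap step.\<close>
  have fixed: "fixed_realisation vs us a b F\<^sub>E F\<^sub>N (f i)" if "i \<le> n" for i
  proof (cases i)
    case 0
    with f(1) assms(11) show ?thesis
      by simp
  next
    case (Suc j)
    with f(3)[of j] that show ?thesis
      by (simp add: swap_step_def)
  qed
  show ?thesis
  \<comment> \<open>A path of \<open>n\<close> steps visits \<open>n + 1\<close> realisations; the
    shift by one makes the numbering start at 1.\<close>
  proof (intro exI[of _ "Suc n"] exI[of _ "\<lambda>i. f (i - 1)"] conjI ballI allI impI)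
    show "real (Suc n) \<le> 1 / 2 * real (card (sym_diff G G'))"
      using n(1) by simp
  next
    fix i assume "1 \<le> i \<and> i < Suc n"
    then have "(f (i - 1), f (i + 1 - 1)) \<in> ?R"
      using f(3)[of "i - 1"] by (simp add: less_diff_conv2)
    then show "card (sym_diff (f (i - 1)) (f (i + 1 - 1))) = 4"
      and "corresponds_to_swap (set vs) (set us) 4 (f (i - 1)) (sym_diff (f (i - 1)) (f (i + 1 - 1)))"
      by (simp_all add: swap_step_def)
  qed (use f fixed in auto)
qed

end
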